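(* If $(\mu;\eta_0)$ is a $\mathcal K$-minimal inequality for $\mathcal S(A,\mathcal K,\mathcal B)$, then $(\mu;\eta_0)$ is a $\mathcal K$-sublinear inequality for $\mathcal S(A,\mathcal K,\mathcal B)$.
   Context: Setting: $E$ is a finite-dimensional Euclidean space with inner product $\langle\cdot,\cdot\rangle$; $\mathcal K\subset E$ is a regular cone (closed, convex, pointed, full-dimensional); $\mathcal K^*=\{y\in E:\langle x,y\rangle\ge0\ \forall x\in\mathcal K\}$ is its dual cone; $A:E\to\mathbb R^m$ is linear; $\mathcal B\subseteq\mathbb R^m$ is an arbitrary nonempty set; $\mathcal S(A,\mathcal K,\mathcal B)=\{x\in\mathcal K: Ax\in\mathcal B\}$, assumed to satisfy $\mathcal S(A,\mathcal K,\mathcal B)\neq\emptyset$ and $\mathcal S(A,\mathcal K,\mathcal B)\ne\mathcal K$. $\mathrm{Ext}(\cdot)$ denotes the set of (nonzero vectors spanning) extreme rays of a cone. A pair $(\mu;\eta_0)\in E\times\mathbb R$ is a valid inequality if $\langle\mu,x\rangle\ge\eta_0$ for all $x\in \mathcal S(A,\mathcal K,\mathcal B)$. A valid inequality $(\mu;\eta_0)$ with $\mu\neq0$ is $\mathcal K$-minimal if every valid inequality $(\rho;\rho_0)$ with $\rho\ne\mu$ and $\mu-\rho\in\mathcal K^*$ satisfies $\rho_0<\eta_0$. An inequality $(\mu;\eta_0)$ with $\mu\ne0$, $\eta_0\in\mathbb R$, is $\mathcal K$-sublinear if (A.1) for every $\alpha\in\mathrm{Ext}(\mathcal K^* )$: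 $0\le\langle\mu,u\rangle$ for all $u\in E$ such that $Au=0$ and $\langle\alpha,v\rangle u+v\in\mathcal K$ for all $v\in\mathrm{Ext}(\mathcal K)$; and (A.2) $\eta_0\le\langle\mu,x\rangle$ for all $x\in\mathcal S(A,\mathcal K,\mathcal B)$. *)

theory Defs
  imports "HOL-Analysis.Analysis"
begin

definition regular_cone :: "'a::euclidean_space set \<Rightarrow> bool" where
  "regular_cone K \<longleftrightarrow> convex_cone K \<and> closed K \<and> K \<inter> uminus ` K = {0} \<and> interior K \<noteq> {}"

definition dual_cone :: "'a::euclidean_space set \<Rightarrow> 'a set" where
  "dual_cone K = {y. \<forall>x\<in>K. 0 \<le> x \<bullet> y}"

text \<open>An extreme ray is a one-dimensional face that is a half-line from the origin;
  it is represented by all the nonzero vectors spanning it, without normalization.\<close>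

definition Ext :: "'a::euclidean_space set \<Rightarrow> 'a set" where
  "Ext K = {x. x \<noteq> 0 \<and> (cone hull {x}) face_of K}"

definition feasible_set ::
  "('a::euclidean_space \<Rightarrow> real^'m) \<Rightarrow> 'a set \<Rightarrow> (real^'m) set \<Rightarrow> 'a set" where
  "feasible_set A K B = {x\<in>K. A x \<in> B}"

definition valid_inequality ::
  "('a::euclidean_space \<Rightarrow> real^'m) \<Rightarrow> 'a set \<Rightarrow> (real^'m) set \<Rightarrow> 'a \<Rightarrow> real \<Rightarrow> bool" where
  "valid_inequality A K B \<mu> \<eta> \<longleftrightarrow> (\<forall>x\<in>feasible_set A K B. \<eta> \<le> \<mu> \<bullet> x)"

definition K_minimal ::
  "('a::euclidean_space \<Rightarrow> real^'m) \<Rightarrow> 'a set \<Rightarrow> (real^'m) set \<Rightarrow> 'a \<Rightarrow> real \<Rightarrow> bool" where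
  "K_minimal A K B \<mu> \<eta> \<longleftrightarrow>
     valid_inequality A K B \<mu> \<eta> \<and> \<mu> \<noteq> 0 \<and>
     (\<forall>\<rho> \<rho>\<^sub>0. valid_inequality A K B \<rho> \<rho>\<^sub>0 \<and> \<rho> \<noteq> \<mu> \<and> \<mu> - \<rho> \<in> dual_cone K \<longrightarrow> \<rho>\<^sub>0 < \<eta>)"

definition K_sublinear ::
  "('a::euclidean_space \<Rightarrow> real^'m) \<Rightarrow> 'a set \<Rightarrow> (real^'m) set \<Rightarrow> 'a \<Rightarrow> real \<Rightarrow> bool" where
  "K_sublinear A K B \<mu> \<eta> \<longleftrightarrow>
     \<mu> \<noteq> 0 \<and>
     (\<forall>\<alpha>\<in>Ext (dual_cone K). \<forall>u.
        A u = 0 \<and> (\<forall>v\<in>Ext K. (\<alpha> \<bullet> v) *\<^sub>R u + v \<in> K) \<longrightarrow> 0 \<le> \<mu> \<bullet> u) \<and>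
     (\<forall>x\<in>feasible_set A K B. \<eta> \<le> \<mu> \<bullet> x)"

end

theory Submission
  imports Defs
begin

text \<open>
  Suppose sublinearity fails at some \<open>\<alpha>\<close> and \<open>u\<close>, that is, \<open>\<mu> \<bullet> u < 0\<close>. Perturb the identity by a rank-one
  map, \<open>Z x = x + (\<alpha> \<bullet> x) u\<close>. By hypothesis \<open>Z\<close> sends every extreme ray of the cone \<open>K\<close> into \<open>K\<close>,
  and a closed pointed cone is generated by its extreme rays, so \<open>Z\<close> maps \<open>K\<close> into itself.
  Moreover \<open>A (Z x) = A x\<close> because \<open>A u = 0\<close>; hence \<open>Z\<close> maps the feasible set into itself, and
  pulling the valid inequality \<open>(\<mu>; \<eta>\<^sub>0)\<close> back along \<open>Z\<close> gives another valid inequality with the same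
  right-hand side. Its left-hand side is the adjoint image \<open>\<rho> = \<mu> + (\<mu> \<bullet> u) \<alpha>\<close>, and
  \<open>\<mu> - \<rho>\<close> is a positive multiple of \<open>\<alpha>\<close>, a nonzero element of the dual cone. So \<open>\<rho>\<close>
  contradicts the minimality of \<open>\<mu>\<close>.

  The substantial ingredient is the generation of a cone by its extreme rays
  (\<open>pointed_cone_subset_hull_Ext\<close>). It follows from the Krein--Milman theorem for the compact slice
  of the cone cut out by a strictly positive functional
  (\<open>pointed_cone_strictly_positive_functional\<close>), since extreme points of this slice span extreme
  rays of the cone (\<open>extreme_point_of_slice_in_Ext\<close>).
\<close>

text \<open>
  Pointedness makes the cone without its apex convex, so the convex hull of the unit vectors in the
  cone is a compact convex set that misses the origin and can be strictly separated from it. The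
  bound proportional to the norm is what later makes slices of the cone bounded.
\<close>

lemma pointed_cone_strictly_positive_functional:
  fixes K :: "'a::euclidean_space set"
  assumes K: "convex_cone K" "closed K" and pointed: "K \<inter> uminus ` K = {0}"
  obtains a b where "0 < b" "\<And>x. x \<in> K \<Longrightarrow> b * norm x \<le> a \<bullet> x"
proof -
  let ?C = "convex hull (K \<inter> sphere 0 1)"
  have "convex (K - {0})"
  proof (rule convexI)
    fix x y :: 'a and s t :: real
    assume x: "x \<in> K - {0}" and y: "y \<in> K - {0}" and st: "0 \<le> s" "0 \<le> t" "s + t = 1"
    have sx: "s *\<^sub>R x \<in> K" and ty: "t *\<^sub>R y \<in> K"
      using x y st K(1) by (auto intro: convex_cone_scaleR)
    have "s *\<^sub>R x + t *\<^sub>R y \<noteq> 0"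
    proof
      assume "s *\<^sub>R x + t *\<^sub>R y = 0"
      then have "s *\<^sub>R x = - (t *\<^sub>R y)"
        by (simp add: eq_neg_iff_add_eq_0)
      with sx ty have "s *\<^sub>R x \<in> K \<inter> uminus ` K"
        by auto
      with pointed have "s *\<^sub>R x = 0"
        by auto
      with \<open>s *\<^sub>R x = - (t *\<^sub>R y)\<close> x y st show False
        by auto
    qed
    then show "s *\<^sub>R x + t *\<^sub>R y \<in> K - {0}"
      using convex_cone_add[OF K(1) sx ty] by simp
  qed
  then have "?C \<subseteq> K - {0}"
    by (intro hull_minimal) auto
  moreover have "closed ?C"
    using closed_Int_compact[OF K(2) compact_sphere] by (intro compact_imp_closed compact_convex_hull)
  ultimately obtain a b where b: "0 < b" and ab: "\<And>x. x \<in> ?C \<Longrightarrow> b < a \<bullet> x"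
    using separating_hyperplane_closed_0[OF convex_convex_hull, of "K \<inter> sphere 0 1"] by blast
  have "b * norm x \<le> a \<bullet> x" if "x \<in> K" for x
  proof (cases "x = 0")
    case False
    have "inverse (norm x) *\<^sub>R x \<in> K \<inter> sphere 0 1"
      using that False K(1) by (simp add: convex_cone_scaleR)
    then have "b < a \<bullet> (inverse (norm x) *\<^sub>R x)"
      by (intro ab hull_inc)
    with False show ?thesis
      by (simp add: field_simps)
  qed simp
  with b that show thesis
    by blast
qed

text \<open>
  Two summands of a point on the ray through \<open>x\<close> can be rescaled into the slice, where they display
  \<open>x\<close> as a convex combination; extremality of \<open>x\<close> then forces both summands onto the ray.
\<close>

lemma extreme_point_of_slice_in_Ext:
  fixes K :: "'a::euclidean_space set"
  assumes K: "convex_cone K" and pos: "\<And>x. x \<in> K \<Longrightarrow> x \<noteq> 0 \<Longrightarrow> 0 < a \<bullet> x"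
    and x: "x extreme_point_of {x \<in> K. a \<bullet> x = 1}"
  shows "x \<in> Ext K"
proof -
  have xK: "x \<in> K" and ax: "a \<bullet> x = 1"
    using x by (auto simp: extreme_point_of_def)
  have "x \<noteq> 0"
    using ax by auto
  have ray: "cone hull {x} = {c *\<^sub>R x |c. 0 \<le> c}"
    by (simp add: cone_hull_expl)
  have summand: "p \<in> cone hull {x}"
    if p: "p \<in> K" and q: "q \<in> K" and pq: "p + q = c *\<^sub>R x" and c: "0 \<le> c" for p q c
  proof (cases "p = 0 \<or> q = 0")
    case True
    then show ?thesis
    proof
      assume "p = 0"
      then have "p = 0 *\<^sub>R x" by simp
      then show ?thesis unfolding ray by blast
    next
      assume "q = 0"
      then show ?thesis using pq c unfolding ray by auto
    qed
  next
    case False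
    define s t where "s = a \<bullet> p" and "t = a \<bullet> q"
    define p' q' where "p' = inverse s *\<^sub>R p" and "q' = inverse t *\<^sub>R q"
    have s: "0 < s" and t: "0 < t"
      using False p q pos by (auto simp: s_def t_def)
    have p': "p = s *\<^sub>R p'" and q': "q = t *\<^sub>R q'"
      using s t by (simp_all add: p'_def q'_def)
    have "s + t = a \<bullet> (p + q)"
      by (simp add: s_def t_def inner_add_right)
    then have st: "s + t = c"
      using pq ax by simp
    have in_slice: "p' \<in> {x \<in> K. a \<bullet> x = 1}" "q' \<in> {x \<in> K. a \<bullet> x = 1}"
      using s t p q K by (auto simp: p'_def q'_def s_def t_def intro: convex_cone_scaleR)
    have "x = inverse c *\<^sub>R (c *\<^sub>R x)"
      using st s t by simp
    also have "\<dots> = (s / c) *\<^sub>R p' + (t / c) *\<^sub>R q'"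
      unfolding pq[symmetric] p' q' by (simp add: scaleR_add_right divide_inverse mult.commute)
    also have "s / c = 1 - t / c"
      using st s t by (simp add: field_simps)
    finally have x_comb: "x = (1 - t / c) *\<^sub>R p' + (t / c) *\<^sub>R q'" .
    have "p' = q'"
    proof (rule ccontr)
      assume "p' \<noteq> q'"
      moreover have "0 < t / c" "t / c < 1"
        using st s t by auto
      ultimately have "x \<in> open_segment p' q'"
        using x_comb by (auto simp: in_segment)
      then show False
        using x in_slice by (auto simp: extreme_point_of_def)
    qed
    then have "x = p'"
      using x_comb by (simp flip: scaleR_add_left)
    then show ?thesis
      using p' s unfolding ray by auto
  qed
  have "(cone hull {x}) face_of K"
    unfolding face_of_def
  proof (intro conjI ballI impI)
    show "cone hull {x} \<subseteq> K"
      using xK K by (auto simp: ray intro: convex_cone_scaleR)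
    show "convex (cone hull {x})"
      by (simp add: convex_cone_hull)
  next
    fix p q z
    assume "p \<in> K" "q \<in> K" "z \<in> cone hull {x}" "z \<in> open_segment p q"
    then obtain c r where c: "0 \<le> c" "z = c *\<^sub>R x"
      and r: "0 < r" "r < 1" "z = (1 - r) *\<^sub>R p + r *\<^sub>R q"
      by (auto simp: ray in_segment)
    have K_rp: "(1 - r) *\<^sub>R p \<in> K" and K_rq: "r *\<^sub>R q \<in> K"
      using \<open>p \<in> K\<close> \<open>q \<in> K\<close> r K by (auto intro: convex_cone_scaleR)
    have "(1 - r) *\<^sub>R p \<in> cone hull {x}" "r *\<^sub>R q \<in> cone hull {x}"
      using summand[OF K_rp K_rq, of c] summand[OF K_rq K_rp, of c] c r
      by (simp_all add: add.commute)
    then have "inverse (1 - r) *\<^sub>R ((1 - r) *\<^sub>R p) \<in> cone hull {x}"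
      "inverse r *\<^sub>R (r *\<^sub>R q) \<in> cone hull {x}"
      using r by (simp_all only: mem_cone[OF cone_cone_hull] inverse_nonnegative_iff_nonnegative
          diff_ge_0_iff_ge less_imp_le)
    then show "p \<in> cone hull {x}" "q \<in> cone hull {x}"
      using r by auto
  qed
  with \<open>x \<noteq> 0\<close> show ?thesis
    by (simp add: Ext_def)
qed

lemma pointed_cone_subset_hull_Ext:
  fixes K :: "'a::euclidean_space set"
  assumes K: "convex_cone K" "closed K" and pointed: "K \<inter> uminus ` K = {0}"
  shows "K \<subseteq> convex_cone hull (Ext K)"
proof -
  obtain a b where b: "0 < b" and ab: "\<And>x. x \<in> K \<Longrightarrow> b * norm x \<le> a \<bullet> x"
    using pointed_cone_strictly_positive_functional[OF assms] by blast
  have pos: "0 < a \<bullet> x" if "x \<in> K" "x \<noteq> 0" for x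
    using ab[OF that(1)] b that(2) by (smt (verit) mult_pos_pos zero_less_norm_iff)
  let ?D = "{x \<in> K. a \<bullet> x = 1}"
  have D: "?D = K \<inter> {x. a \<bullet> x = 1}"
    by auto
  have "norm x \<le> 1 / b" if "x \<in> ?D" for x
    using that ab[of x] b by (simp add: field_simps)
  then have "bounded ?D"
    by (auto intro: boundedI)
  moreover have "closed ?D"
    unfolding D using K(2) by (intro closed_Int closed_hyperplane)
  ultimately have "compact ?D"
    by (simp add: compact_eq_bounded_closed)
  moreover have "convex ?D"
    unfolding D using K(1) by (intro convex_Int convex_hyperplane) (simp add: convex_cone_def)
  ultimately have "?D = convex hull {x. x extreme_point_of ?D}"
    by (rule Krein_Milman_Minkowski)
  also have "\<dots> \<subseteq> convex_cone hull (Ext K)"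
  proof (rule hull_minimal)
    show "{x. x extreme_point_of ?D} \<subseteq> convex_cone hull (Ext K)"
      using extreme_point_of_slice_in_Ext[OF K(1) pos] by (blast intro: hull_inc)
  qed (rule convex_convex_cone_hull)
  finally have D_subset: "?D \<subseteq> convex_cone hull (Ext K)" .
  show ?thesis
  proof
    fix x assume "x \<in> K"
    show "x \<in> convex_cone hull (Ext K)"
    proof (cases "x = 0")
      case True
      then show ?thesis by (simp add: convex_cone_hull_contains_0)
    next
      case False
      let ?y = "inverse (a \<bullet> x) *\<^sub>R x"
      have "0 < a \<bullet> x"
        using pos \<open>x \<in> K\<close> False by blast
      then have "?y \<in> ?D"
        using \<open>x \<in> K\<close> K(1) by (auto intro: convex_cone_scaleR)
      with D_subset have "(a \<bullet> x) *\<^sub>R ?y \<in> convex_cone hull (Ext K)"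
        using \<open>0 < a \<bullet> x\<close> by (blast intro: convex_cone_hull_mul less_imp_le)
      then show ?thesis
        using \<open>0 < a \<bullet> x\<close> by simp
    qed
  qed
qed

lemma linear_maps_cone_into_cone_if_Ext:
  fixes K :: "'a::euclidean_space set" and Z :: "'a \<Rightarrow> 'b::euclidean_space"
  assumes K: "convex_cone K" "closed K" "K \<inter> uminus ` K = {0}"
    and L: "convex_cone L"
    and Z: "linear Z" "\<And>v. v \<in> Ext K \<Longrightarrow> Z v \<in> L"
    and x: "x \<in> K"
  shows "Z x \<in> L"
proof -
  have "convex_cone (Z -` L)"
    using L by (auto simp: convex_cone_iff linear_add[OF Z(1)] linear_scale[OF Z(1)]
        linear_0[OF Z(1)])
  then have "convex_cone hull (Ext K) \<subseteq> Z -` L"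
    using Z(2) by (intro hull_minimal) auto
  then show ?thesis
    using pointed_cone_subset_hull_Ext[OF K] x by auto
qed

theorem theorem3p1:
  fixes K :: "'a::euclidean_space set"
    and A :: "'a \<Rightarrow> real^'m"
    and B :: "(real^'m) set"
    and \<mu> :: 'a and \<eta>\<^sub>0 :: real
  assumes "regular_cone K"
    and "linear A"
    and "B \<noteq> {}"
    and "feasible_set A K B \<noteq> {}"
    and "feasible_set A K B \<noteq> K"
    and "K_minimal A K B \<mu> \<eta>\<^sub>0"
  shows "K_sublinear A K B \<mu> \<eta>\<^sub>0"
proof -
  have valid: "\<And>x. x \<in> feasible_set A K B \<Longrightarrow> \<eta>\<^sub>0 \<le> \<mu> \<bullet> x" and "\<mu> \<noteq> 0"
    and minimal: "\<And>\<rho> \<rho>\<^sub>0. valid_inequality A K B \<rho> \<rho>\<^sub>0 \<Longrightarrow> \<rho> \<noteq> \<mu> \<Longrightarrow> \<mu> - \<rho> \<in> dual_cone K \<Longrightarrow> \<rho>\<^sub>0 < \<eta>\<^sub>0"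
    using assms(6) by (auto simp: K_minimal_def valid_inequality_def)
  have K: "convex_cone K" "closed K" "K \<inter> uminus ` K = {0}"
    using assms(1) by (auto simp: regular_cone_def)
  have "0 \<le> \<mu> \<bullet> u"
    if \<alpha>: "\<alpha> \<in> Ext (dual_cone K)" and Au: "A u = 0"
      and u: "\<And>v. v \<in> Ext K \<Longrightarrow> (\<alpha> \<bullet> v) *\<^sub>R u + v \<in> K" for \<alpha> u
  proof (rule ccontr)
    assume "\<not> 0 \<le> \<mu> \<bullet> u"
    then have neg: "\<mu> \<bullet> u < 0" by simp
    define Z where "Z x = (\<alpha> \<bullet> x) *\<^sub>R u + x" for x
    define \<rho> where "\<rho> = \<mu> + (\<mu> \<bullet> u) *\<^sub>R \<alpha>"
    have linear_Z: "linear Z"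
      by (rule linearI) (simp_all add: Z_def inner_add_right algebra_simps)
    have ZK: "Z x \<in> K" if "x \<in> K" for x
      using linear_maps_cone_into_cone_if_Ext[OF K K(1) linear_Z _ that] u
      by (simp add: Z_def)
    have AZ: "A (Z x) = A x" for x
      using Au by (simp add: Z_def linear_add[OF assms(2)] linear_scale[OF assms(2)])
    have \<rho>_eq: "\<rho> \<bullet> x = \<mu> \<bullet> Z x" for x
      by (simp add: \<rho>_def Z_def inner_add_left inner_add_right)
    have "Z x \<in> feasible_set A K B" if "x \<in> feasible_set A K B" for x
      using that ZK AZ by (simp add: feasible_set_def)
    then have "valid_inequality A K B \<rho> \<eta>\<^sub>0"
      using valid by (simp add: valid_inequality_def \<rho>_eq)
    moreover have "\<rho> \<noteq> \<mu>"
      using neg \<alpha> by (simp add: \<rho>_def Ext_def)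
    moreover have "\<mu> - \<rho> \<in> dual_cone K"
    proof -
      have "\<alpha> \<in> cone hull {\<alpha>}"
        by (simp add: hull_inc)
      then have "\<alpha> \<in> dual_cone K"
        using \<alpha> face_of_imp_subset by (auto simp: Ext_def)
      then show ?thesis
        using neg by (auto simp: \<rho>_def dual_cone_def mult_nonpos_nonneg)
    qed
    ultimately show False
      using minimal by blast
  qed
  then show ?thesis
    using valid \<open>\<mu> \<noteq> 0\<close> by (auto simp: K_sublinear_def)
qed

end
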